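(* Let $C$ be a unital $C^*$-algebra and $B\subseteq\mathcal B(H)$ a finite-dimensional $C^*$-algebra, with $H$ a finite-dimensional Hilbert space. Let $\theta:C\to B$ be a unital completely positive map, and let $(V,\rho,\pi,K)$ be a Stinespring dilation of $\theta$. Define $\hat\theta:\pi(C)'\to\mathcal B(H)$ by $\hat\theta(y)=V^*yV$. Then $S=\hat\theta(\pi(C)')$ is a quantum graph over $B$. This definition of $S$ is independent of the choice of $V,\rho,\pi,K$ (in particular, $K$ is not required to be minimal).
   Context: $B$ is a unital $*$-subalgebra of $\mathcal B(H)$ with commutant $B'$. A quantum graph over $B\subseteq\mathcal B(H)$ is a subspace $S\subseteq\mathcal B(H)$ which is an operator bimodule over $B'$: $xsy\in S$ for all $x,y\in B'$, $s\in S$. A Stinespring dilation $(V,\rho,\pi,K)$ of the unital completely positive map $\theta:C\to B\subseteq\mathcal B(H)$ consists of a Hilbert space $K$, a non-degenerate $*$-homomorphism $\pi:C\to\mathcal B(K)$, an isometry $V:H\to K$, and a normal unital $*$-homomorphism $\rho:B'\to\pi(C)'$, with $\theta(c)=V^*\pi(c)V$ for all $c\in C$ and $\rho(x)V=Vx$ for all $x\in B'$. No minimality (that $\mathrm{lin}\{\pi(c)V\xi\}$ be dense in $K$) is required. Such dilations always exist. Here $\pi(C)'$ is the commutant of $\pi(C)$ in $\mathcal B(K)$. *)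

theory Defs
  imports "HOL-Analysis.Analysis"
begin

class complex_vector = real_vector +
  fixes scaleC :: "complex \<Rightarrow> 'a \<Rightarrow> 'a"  (infixr \<open>*\<^sub>C\<close> 75)
  assumes scaleC_add_right: "a *\<^sub>C (x + y) = a *\<^sub>C x + a *\<^sub>C y"
    and scaleC_add_left: "(a + b) *\<^sub>C x = a *\<^sub>C x + b *\<^sub>C x"
    and scaleC_scaleC: "a *\<^sub>C (b *\<^sub>C x) = (a * b) *\<^sub>C x"
    and scaleC_one: "1 *\<^sub>C x = x"
    and scaleR_scaleC: "r *\<^sub>R x = complex_of_real r *\<^sub>C x"

global_interpretation complex_vector:
  vector_space "scaleC :: complex \<Rightarrow> 'a \<Rightarrow> 'a::complex_vector"
  defines csubspace = complex_vector.subspace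
    and cspan = complex_vector.span
  by unfold_locales
    (simp_all add: scaleC_add_right scaleC_add_left scaleC_scaleC scaleC_one)

definition finite_cdim :: "'a::complex_vector set \<Rightarrow> bool" where
  "finite_cdim S \<longleftrightarrow> (\<exists>F. finite F \<and> S \<subseteq> cspan F)"

text \<open>
  The complex inner product is conjugate-linear in the first argument.  Since
  \<open>inner_eq_Re_cinner\<close> ties its real part to the library's real inner product, the norm
  (and hence the topology) is the one induced by the complex inner product.
\<close>

class complex_inner = complex_vector + real_inner +
  fixes cinner :: "'a \<Rightarrow> 'a \<Rightarrow> complex"
  assumes cinner_commute: "cinner x y = cnj (cinner y x)"
    and cinner_add_right: "cinner x (y + z) = cinner x y + cinner x z"
    and cinner_scaleC_right: "cinner x (a *\<^sub>C y) = a * cinner x y"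
    and inner_eq_Re_cinner: "inner x y = Re (cinner x y)"

class chilbert_space = complex_inner + complete_space

text \<open>The zero algebra is allowed: \<open>1 \<noteq> 0\<close> is not assumed.\<close>

class unital_cstar_algebra = complex_vector + real_normed_algebra + monoid_mult + banach +
  fixes star :: "'a \<Rightarrow> 'a"
  assumes norm_scaleC: "norm (a *\<^sub>C x) = cmod a * norm x"
    and mult_scaleC_left: "(a *\<^sub>C x) * y = a *\<^sub>C (x * y)"
    and mult_scaleC_right: "x * (a *\<^sub>C y) = a *\<^sub>C (x * y)"
    and star_add: "star (x + y) = star x + star y"
    and star_scaleC: "star (a *\<^sub>C x) = cnj a *\<^sub>C star x"
    and star_mult: "star (x * y) = star y * star x"
    and star_star: "star (star x) = x"
    and cstar_identity: "norm (star x * x) = (norm x)\<^sup>2"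

typedef (overloaded) ('a, 'b) cblinfun =
  "{f :: 'a::complex_inner \<Rightarrow> 'b::complex_inner.
     bounded_linear f \<and> (\<forall>a x. f (a *\<^sub>C x) = a *\<^sub>C f x)}"
  morphisms cblinfun_apply CBlinfun
  by (rule exI[of _ "\<lambda>_. 0"])
    (auto simp: complex_vector.scale_zero_right)

notation cblinfun_apply  (infixr \<open>*\<^sub>V\<close> 70)

setup_lifting type_definition_cblinfun

lemma bounded_linear_scaleC: "bounded_linear (\<lambda>x :: 'a::complex_inner. a *\<^sub>C x)"
proof -
  have sq: "(norm (a *\<^sub>C x))\<^sup>2 = (cmod a * norm x)\<^sup>2" for x :: 'a
  proof -
    have 1: "cinner (a *\<^sub>C x) y = cnj a * cinner x y" for y
      by (metis cinner_commute cinner_scaleC_right complex_cnj_mult)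
    have 2: "cinner (a *\<^sub>C x) (a *\<^sub>C x) = (cnj a * a) * cinner x x"
      by (simp add: 1 cinner_scaleC_right)
    have 3: "cnj a * a = complex_of_real ((cmod a)\<^sup>2)"
      by (metis complex_norm_square mult.commute)
    have "Re (cinner (a *\<^sub>C x) (a *\<^sub>C x)) = (cmod a)\<^sup>2 * Re (cinner x x)"
      unfolding 2 3 by simp
    then show ?thesis
      by (simp add: power2_norm_eq_inner inner_eq_Re_cinner power_mult_distrib)
  qed
  have "norm (a *\<^sub>C x) = cmod a * norm x" for x :: 'a
    using sq[of x] by (simp add: power2_eq_iff_nonneg)
  then show ?thesis
    by (intro bounded_linear_intro[of _ "cmod a"])
      (simp_all add: scaleC_add_right scaleR_scaleC scaleC_scaleC mult.commute)
qed

instantiation cblinfun :: (complex_inner, complex_inner) complex_vector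
begin

lift_definition zero_cblinfun :: "('a, 'b) cblinfun" is "\<lambda>_. 0"
  by (simp add: complex_vector.scale_zero_right)

lift_definition plus_cblinfun :: "('a, 'b) cblinfun \<Rightarrow> ('a, 'b) cblinfun \<Rightarrow> ('a, 'b) cblinfun"
  is "\<lambda>f g x. f x + g x"
  by (auto simp: scaleC_add_right intro: bounded_linear_add)

lift_definition uminus_cblinfun :: "('a, 'b) cblinfun \<Rightarrow> ('a, 'b) cblinfun"
  is "\<lambda>f x. - f x"
  by (auto simp: complex_vector.scale_minus_right intro: bounded_linear_minus)

lift_definition minus_cblinfun :: "('a, 'b) cblinfun \<Rightarrow> ('a, 'b) cblinfun \<Rightarrow> ('a, 'b) cblinfun"
  is "\<lambda>f g x. f x - g x"
  by (auto simp: complex_vector.scale_right_diff_distrib intro: bounded_linear_sub)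

lift_definition scaleC_cblinfun :: "complex \<Rightarrow> ('a, 'b) cblinfun \<Rightarrow> ('a, 'b) cblinfun"
  is "\<lambda>a f x. a *\<^sub>C f x"
  by (auto simp: scaleC_scaleC mult.commute
      intro: bounded_linear_compose[OF bounded_linear_scaleC])

lift_definition scaleR_cblinfun :: "real \<Rightarrow> ('a, 'b) cblinfun \<Rightarrow> ('a, 'b) cblinfun"
  is "\<lambda>r f x. r *\<^sub>R f x"
  by (auto simp: scaleR_scaleC scaleC_scaleC mult.commute
      intro: bounded_linear_compose[OF bounded_linear_scaleC])

instance
  by standard
    (transfer; simp add: fun_eq_iff scaleR_scaleC scaleC_add_right scaleC_add_left
      scaleC_scaleC scaleC_one; fail)+

end

lift_definition id_cblinfun :: "('a::complex_inner, 'a) cblinfun" is "\<lambda>x. x"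
  by simp

lift_definition cblinfun_compose ::
    "('b::complex_inner, 'c::complex_inner) cblinfun \<Rightarrow> ('a::complex_inner, 'b) cblinfun
      \<Rightarrow> ('a, 'c) cblinfun"  (infixl \<open>o\<^sub>C\<close> 67)
  is "\<lambda>f g x. f (g x)"
  by (auto intro: bounded_linear_compose)

text \<open>Existence of the adjoint is the Riesz representation theorem; uniqueness is immediate.\<close>

definition adj :: "('a::chilbert_space, 'b::chilbert_space) cblinfun \<Rightarrow> ('b, 'a) cblinfun" where
  "adj T = (THE S. \<forall>x y. cinner (T *\<^sub>V x) y = cinner x (S *\<^sub>V y))"

definition isometry :: "('a::chilbert_space, 'b::chilbert_space) cblinfun \<Rightarrow> bool" where
  "isometry V \<longleftrightarrow> (\<forall>x. norm (V *\<^sub>V x) = norm x)"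

definition commutant ::
    "('a::chilbert_space, 'a) cblinfun set \<Rightarrow> ('a, 'a) cblinfun set" where
  "commutant M = {x. \<forall>b\<in>M. x o\<^sub>C b = b o\<^sub>C x}"

text \<open>
  The weak* topology on the bounded operators, given by the normal functionals
  \<open>T \<mapsto> \<Sum>n. \<langle>\<xi>\<^sub>n, T \<eta>\<^sub>n\<rangle>\<close> with \<open>\<xi>\<close> and \<open>\<eta>\<close> square-summable.
\<close>

definition sigma_weak_topology :: "('a::chilbert_space, 'a) cblinfun topology" where
  "sigma_weak_topology = topology_generated_by
     {{T. (\<Sum>n. cinner (\<xi> n) (T *\<^sub>V \<eta> n)) \<in> U} | (\<xi> :: nat \<Rightarrow> 'a) \<eta> U.
        summable (\<lambda>n. (norm (\<xi> n))\<^sup>2) \<and> summable (\<lambda>n. (norm (\<eta> n))\<^sup>2) \<and> open U}"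

text \<open>
  Only finite-dimensional algebras of operators are considered below, and these are
  automatically norm closed.
\<close>

definition unital_star_subalgebra :: "('h::chilbert_space, 'h) cblinfun set \<Rightarrow> bool" where
  "unital_star_subalgebra B \<longleftrightarrow>
     csubspace B \<and> id_cblinfun \<in> B \<and>
     (\<forall>a\<in>B. \<forall>b\<in>B. a o\<^sub>C b \<in> B) \<and> (\<forall>a\<in>B. adj a \<in> B)"

text \<open>
  A subspace and bimodule over the commutant; over a finite-dimensional Hilbert space no
  closedness condition is needed.
\<close>

definition quantum_graph ::
    "('h::chilbert_space, 'h) cblinfun set \<Rightarrow> ('h, 'h) cblinfun set \<Rightarrow> bool" where
  "quantum_graph B S \<longleftrightarrow>
     csubspace S \<and>
     (\<forall>x\<in>commutant B. \<forall>y\<in>commutant B. \<forall>s\<in>S. x o\<^sub>C s o\<^sub>C y \<in> S)"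

text \<open>
  An \<open>n \<times> n\<close> matrix is a function of two indices, of which only the values at indices
  below \<open>n\<close> matter.  A matrix over an abstract C*-algebra is positive if it is of the form
  \<open>x\<^sup>* x\<close> in the matrix algebra; a matrix of operators is positive if it is positive as an
  operator on the \<open>n\<close>-fold direct sum of the Hilbert space.
\<close>

definition matrix_positive :: "nat \<Rightarrow> (nat \<Rightarrow> nat \<Rightarrow> 'c::unital_cstar_algebra) \<Rightarrow> bool" where
  "matrix_positive n a \<longleftrightarrow>
     (\<exists>x :: nat \<Rightarrow> nat \<Rightarrow> 'c. \<forall>i<n. \<forall>j<n. a i j = (\<Sum>k<n. star (x k i) * x k j))"

definition operator_matrix_positive ::
    "nat \<Rightarrow> (nat \<Rightarrow> nat \<Rightarrow> ('h::chilbert_space, 'h) cblinfun) \<Rightarrow> bool" where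
  "operator_matrix_positive n T \<longleftrightarrow>
     (\<forall>\<xi> :: nat \<Rightarrow> 'h. (\<Sum>i<n. \<Sum>j<n. cinner (\<xi> i) (T i j *\<^sub>V \<xi> j)) \<in> \<real>\<^sub>\<ge>\<^sub>0)"

definition completely_positive ::
    "('c::unital_cstar_algebra \<Rightarrow> ('h::chilbert_space, 'h) cblinfun) \<Rightarrow> bool" where
  "completely_positive \<theta> \<longleftrightarrow>
     (\<forall>n a. matrix_positive n a \<longrightarrow> operator_matrix_positive n (\<lambda>i j. \<theta> (a i j)))"

definition clinear_map :: "('a::complex_vector \<Rightarrow> 'b::complex_vector) \<Rightarrow> bool" where
  "clinear_map f \<longleftrightarrow>
     (\<forall>x y. f (x + y) = f x + f y) \<and> (\<forall>a x. f (a *\<^sub>C x) = a *\<^sub>C f x)"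

definition ucp_map ::
    "('h::chilbert_space, 'h) cblinfun set
      \<Rightarrow> ('c::unital_cstar_algebra \<Rightarrow> ('h, 'h) cblinfun) \<Rightarrow> bool" where
  "ucp_map B \<theta> \<longleftrightarrow>
     range \<theta> \<subseteq> B \<and> clinear_map \<theta> \<and> \<theta> 1 = id_cblinfun \<and> completely_positive \<theta>"

definition star_representation ::
    "('c::unital_cstar_algebra \<Rightarrow> ('k::chilbert_space, 'k) cblinfun) \<Rightarrow> bool" where
  "star_representation \<pi> \<longleftrightarrow>
     clinear_map \<pi> \<and> (\<forall>a b. \<pi> (a * b) = \<pi> a o\<^sub>C \<pi> b) \<and> (\<forall>a. \<pi> (star a) = adj (\<pi> a))"

definition nondegenerate ::
    "('c::unital_cstar_algebra \<Rightarrow> ('k::chilbert_space, 'k) cblinfun) \<Rightarrow> bool" where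
  "nondegenerate \<pi> \<longleftrightarrow> closure (cspan {\<pi> c *\<^sub>V \<xi> | c \<xi>. True}) = UNIV"

definition normal_unital_star_hom ::
    "('h::chilbert_space, 'h) cblinfun set \<Rightarrow> ('k::chilbert_space, 'k) cblinfun set
      \<Rightarrow> (('h, 'h) cblinfun \<Rightarrow> ('k, 'k) cblinfun) \<Rightarrow> bool" where
  "normal_unital_star_hom M N \<rho> \<longleftrightarrow>
     \<rho> ` M \<subseteq> N \<and>
     (\<forall>x\<in>M. \<forall>y\<in>M. \<rho> (x + y) = \<rho> x + \<rho> y) \<and>
     (\<forall>a. \<forall>x\<in>M. \<rho> (a *\<^sub>C x) = a *\<^sub>C \<rho> x) \<and>
     (\<forall>x\<in>M. \<forall>y\<in>M. \<rho> (x o\<^sub>C y) = \<rho> x o\<^sub>C \<rho> y) \<and>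
     (\<forall>x\<in>M. \<rho> (adj x) = adj (\<rho> x)) \<and>
     \<rho> id_cblinfun = id_cblinfun \<and>
     continuous_map (subtopology sigma_weak_topology M) (subtopology sigma_weak_topology N) \<rho>"

definition stinespring_dilation ::
    "('h::chilbert_space, 'h) cblinfun set \<Rightarrow> ('c::unital_cstar_algebra \<Rightarrow> ('h, 'h) cblinfun)
      \<Rightarrow> ('h, 'k::chilbert_space) cblinfun \<Rightarrow> (('h, 'h) cblinfun \<Rightarrow> ('k, 'k) cblinfun)
      \<Rightarrow> ('c \<Rightarrow> ('k, 'k) cblinfun) \<Rightarrow> bool" where
  "stinespring_dilation B \<theta> V \<rho> \<pi> \<longleftrightarrow>
     star_representation \<pi> \<and> nondegenerate \<pi> \<and>
     isometry V \<and>
     normal_unital_star_hom (commutant B) (commutant (range \<pi>)) \<rho> \<and>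
     (\<forall>c. \<theta> c = adj V o\<^sub>C \<pi> c o\<^sub>C V) \<and>
     (\<forall>x\<in>commutant B. \<rho> x o\<^sub>C V = V o\<^sub>C x)"

definition theta_hat ::
    "('h::chilbert_space, 'k::chilbert_space) cblinfun \<Rightarrow> ('k, 'k) cblinfun
      \<Rightarrow> ('h, 'h) cblinfun" where
  "theta_hat V y = adj V o\<^sub>C y o\<^sub>C V"

end

theory Submission
  imports Defs
begin

text \<open>
  The bimodule property is the identity \<open>x V\<^sup>* y V z = V\<^sup>* \<rho>(x) y \<rho>(z) V\<close>.  For the
  independence, two dilations of \<open>\<theta>\<close> are compared by a bounded intertwiner \<open>T\<close> with
  \<open>T \<pi>'(c) = \<pi>(c) T\<close> and \<open>T V' = V\<close>: then \<open>y \<mapsto> T\<^sup>* y T\<close> maps \<open>\<pi>(C)'\<close> into \<open>\<pi>'(C)'\<close>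
  and \<open>V'\<^sup>* T\<^sup>* y T V' = V\<^sup>* y V\<close>.  Such a \<open>T\<close> is the partial isometry between the minimal
  subspaces of the two dilations.
\<close>

section \<open>Orthogonal projection and the adjoint\<close>

lemma subspace_closure:
  fixes S :: "'a::real_normed_vector set"
  assumes "subspace S"
  shows "subspace (closure S)"
proof (rule subspaceI)
  show "0 \<in> closure S"
    using assms closure_subset subspace_0 by blast
next
  fix x y assume "x \<in> closure S" "y \<in> closure S"
  then obtain a b where ab: "\<forall>n. a n \<in> S" "a \<longlonglongrightarrow> x" "\<forall>n. b n \<in> S" "b \<longlonglongrightarrow> y"
    unfolding closure_sequential by blast
  then show "x + y \<in> closure S"
    using assms unfolding closure_sequential
    by (intro exI[of _ "\<lambda>n. a n + b n"]) (auto intro: subspace_add tendsto_add)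
next
  fix c x assume "x \<in> closure S"
  then obtain a where a: "\<forall>n. a n \<in> S" "a \<longlonglongrightarrow> x"
    unfolding closure_sequential by blast
  then show "c *\<^sub>R x \<in> closure S"
    using assms unfolding closure_sequential
    by (intro exI[of _ "\<lambda>n. c *\<^sub>R a n"]) (auto intro: subspace_scale tendsto_intros)
qed

text \<open>Invariance of the closed span \<open>G\<close> under an operator is thereby reduced to a
  check on generators.\<close>

lemma bounded_linear_maps_closure_span:
  assumes f: "bounded_linear f" and gen: "\<And>x. x \<in> X \<Longrightarrow> f x \<in> Y"
    and x: "x \<in> closure (span X)"
  shows "f x \<in> closure (span Y)"
proof -
  have "f ` span X = span (f ` X)"
    using linear_span_image[OF bounded_linear.linear[OF f]] by blast
  also have "\<dots> \<subseteq> span Y"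
    using gen by (intro span_mono) auto
  finally show ?thesis
    using closure_bounded_linear_image_subset[OF f] x closure_mono by blast
qed

text \<open>First variation: moving \<open>p\<close> along \<open>g\<close> stays inside
  \<open>M\<close>, so a nonzero inner product would allow a strictly closer point.\<close>

lemma closest_point_imp_orthogonal:
  fixes M :: "'a::real_inner set"
  assumes M: "subspace M" "p \<in> M" "g \<in> M"
    and min: "\<And>m. m \<in> M \<Longrightarrow> norm (x - p) \<le> norm (x - m)"
  shows "inner (x - p) g = 0"
proof (cases "g = 0")
  case False
  define u where "u = x - p"
  \<comment> \<open>This \<open>t\<close> minimises the quadratic
    \<open>norm (u - t *\<^sub>R g)\<close> squared, lowering it by the square of
    \<open>inner u g\<close> over \<open>inner g g\<close>.\<close>
  define t where "t = inner u g / inner g g"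
  have gg: "inner g g > 0"
    using False by simp
  have "p + t *\<^sub>R g \<in> M"
    using M by (auto intro: subspace_add subspace_scale)
  from min[OF this] have "norm u \<le> norm (u - t *\<^sub>R g)"
    by (simp add: u_def algebra_simps)
  then have "inner u u \<le> inner (u - t *\<^sub>R g) (u - t *\<^sub>R g)"
    by (simp add: norm_le)
  also have "\<dots> = inner u u - 2 * t * inner u g + t * (t * inner g g)"
    by (simp add: inner_diff inner_commute algebra_simps)
  also have "t * inner g g = inner u g"
    using gg by (simp add: t_def)
  finally have "t * inner u g \<le> 0"
    by simp
  then have "(inner u g)\<^sup>2 \<le> 0"
    using gg by (simp add: t_def power2_eq_square divide_le_0_iff)
  then show ?thesis
    by (simp add: u_def)
qed simp

text \<open>A sequence in \<open>M\<close> whose distances to \<open>x\<close> approach the infimum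
  is Cauchy by the parallelogram law, and its limit is a closest point. The real setting covers both
  kernels of real functionals and the graph \<open>G\<close> inside a product space.\<close>

lemma orthogonal_projection_exists:
  fixes M :: "'a::{real_inner, complete_space} set"
  assumes M: "subspace M" "closed M"
  shows "\<exists>p\<in>M. \<forall>g\<in>M. inner (x - p) g = 0"
proof -
  define d where "d = infdist x M"
  have ne: "M \<noteq> {}"
    using M subspace_0 by blast
  have "\<exists>a\<in>M. dist x a < d + inverse (real (Suc n))" for n
  proof (rule ccontr)
    assume "\<not> ?thesis"
    then have "d + inverse (real (Suc n)) \<le> (INF a\<in>M. dist x a)"
      using ne by (intro cINF_greatest) force+
    then show False
      using ne by (simp add: d_def infdist_notempty)
  qed
  then obtain a where a: "\<And>n. a n \<in> M" "\<And>n. dist x (a n) < d + inverse (real (Suc n))"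
    by metis
  have d0: "0 \<le> d"
    by (simp add: d_def infdist_nonneg)
  have lim: "(\<lambda>n. dist x (a n)) \<longlonglongrightarrow> d"
  proof (rule tendsto_sandwich)
    show "\<forall>\<^sub>F n in sequentially. d \<le> dist x (a n)"
      using a by (simp add: d_def infdist_le)
    show "\<forall>\<^sub>F n in sequentially. dist x (a n) \<le> d + inverse (real (Suc n))"
      using a by (simp add: less_imp_le)
    show "(\<lambda>n. d + inverse (real (Suc n))) \<longlonglongrightarrow> d"
      using tendsto_add[OF tendsto_const LIMSEQ_inverse_real_of_nat] by simp
  qed simp
  have para: "(dist (a m) (a n))\<^sup>2 \<le> 2 * ((dist x (a m))\<^sup>2 - d\<^sup>2) + 2 * ((dist x (a n))\<^sup>2 - d\<^sup>2)"
    for m n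
  proof -
    \<comment> \<open>The midpoint lies in \<open>M\<close>, hence at distance at least
      \<open>d\<close> from \<open>x\<close>. The parallelogram law for \<open>x - a m\<close> and
      \<open>x - a n\<close>, whose sum is \<open>2 *\<^sub>R (x - c)\<close>, then bounds
      \<open>a m - a n\<close>.\<close>
    define c where "c = (1/2) *\<^sub>R (a m + a n)"
    have "c \<in> M"
      using M a by (auto simp: c_def intro: subspace_add subspace_scale)
    then have "d \<le> norm (x - c)"
      using infdist_le[of c M x] by (simp add: d_def dist_norm)
    then have "d\<^sup>2 \<le> (norm (x - c))\<^sup>2"
      using d0 by (simp add: power_mono)
    moreover have "(norm (a m - a n))\<^sup>2 + 4 * (norm (x - c))\<^sup>2
        = 2 * (norm (x - a m))\<^sup>2 + 2 * (norm (x - a n))\<^sup>2"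
      unfolding power2_norm_eq_inner c_def
      by (simp add: inner_diff inner_add inner_commute algebra_simps)
    ultimately show ?thesis
      by (simp add: dist_norm)
  qed
  have "Cauchy a"
  proof (rule metric_CauchyI)
    fix e :: real assume e: "0 < e"
    have "(\<lambda>n. (dist x (a n))\<^sup>2 - d\<^sup>2) \<longlonglongrightarrow> d\<^sup>2 - d\<^sup>2"
      by (intro tendsto_intros lim)
    then have "\<forall>\<^sub>F n in sequentially. (dist x (a n))\<^sup>2 - d\<^sup>2 < e\<^sup>2 / 4"
      using e by (intro order_tendstoD(2)) auto
    then obtain N where N: "\<And>n. n \<ge> N \<Longrightarrow> (dist x (a n))\<^sup>2 - d\<^sup>2 < e\<^sup>2 / 4"
      unfolding eventually_sequentially by blast
    have "dist (a m) (a n) < e" if "m \<ge> N" "n \<ge> N" for m n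
    proof -
      have "(dist (a m) (a n))\<^sup>2 < e\<^sup>2"
        using para[of m n] N[OF that(1)] N[OF that(2)] by (simp add: field_simps)
      then show ?thesis
        using e power2_less_imp_less by (metis less_imp_le)
    qed
    then show "\<exists>N. \<forall>m\<ge>N. \<forall>n\<ge>N. dist (a m) (a n) < e"
      by blast
  qed
  then obtain p where p: "a \<longlonglongrightarrow> p"
    using Cauchy_convergent convergent_def by blast
  have "p \<in> M"
    using M(2) a(1) p closed_sequentially by blast
  moreover have "dist x p = d"
    using tendsto_dist[OF tendsto_const[of x] p] lim LIMSEQ_unique by blast
  then have "norm (x - p) \<le> norm (x - m)" if "m \<in> M" for m
    using infdist_le[OF that, of x] by (simp add: d_def dist_norm)
  ultimately show ?thesis
    using closest_point_imp_orthogonal[OF M(1)] by blast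
qed

definition orth_proj :: "'a::{real_inner, complete_space} set \<Rightarrow> 'a \<Rightarrow> 'a" where
  "orth_proj M x = (SOME p. p \<in> M \<and> (\<forall>g\<in>M. inner (x - p) g = 0))"

context
  fixes M :: "'a::{real_inner, complete_space} set"
  assumes M: "subspace M" "closed M"
begin

lemma orth_proj_in: "orth_proj M x \<in> M"
  and orth_proj_orthogonal: "g \<in> M \<Longrightarrow> inner (x - orth_proj M x) g = 0"
  using someI_ex[of "\<lambda>p. p \<in> M \<and> (\<forall>g\<in>M. inner (x - p) g = 0)"]
    orthogonal_projection_exists[OF M, of x]
  by (auto simp: orth_proj_def)

text \<open>The difference of two candidates lies in \<open>M\<close> and is orthogonal to
  \<open>M\<close>, hence to itself. Later identities for \<open>orth_proj\<close> follow by
  exhibiting a candidate.\<close>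

lemma orth_proj_unique:
  assumes "p \<in> M" "\<And>g. g \<in> M \<Longrightarrow> inner (x - p) g = 0"
  shows "orth_proj M x = p"
proof -
  let ?q = "orth_proj M x"
  have "p - ?q \<in> M"
    using M assms orth_proj_in by (auto intro: subspace_diff)
  then have "inner (x - ?q) (p - ?q) - inner (x - p) (p - ?q) = 0"
    using assms(2) orth_proj_orthogonal by simp
  then have "inner (p - ?q) (p - ?q) = 0"
    by (simp flip: inner_diff_left)
  then show ?thesis
    by simp
qed

text \<open>Linearity comes from uniqueness; the bound comes from
  \<open>inner (P x) (P x) = inner x (P x)\<close>, with \<open>P\<close> the projection, and
  Cauchy-Schwarz.\<close>

lemma bounded_linear_orth_proj: "bounded_linear (orth_proj M)"
proof (rule bounded_linear_intro[of _ 1])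
  fix x y
  show "orth_proj M (x + y) = orth_proj M x + orth_proj M y"
  proof (rule orth_proj_unique)
    show "orth_proj M x + orth_proj M y \<in> M"
      using M orth_proj_in by (auto intro: subspace_add)
    show "inner (x + y - (orth_proj M x + orth_proj M y)) g = 0" if "g \<in> M" for g
      using orth_proj_orthogonal[OF that, of x] orth_proj_orthogonal[OF that, of y]
      by (simp add: inner_diff_left inner_add_left)
  qed
next
  fix r x
  show "orth_proj M (r *\<^sub>R x) = r *\<^sub>R orth_proj M x"
  proof (rule orth_proj_unique)
    show "r *\<^sub>R orth_proj M x \<in> M"
      using M orth_proj_in by (auto intro: subspace_scale)
    show "inner (r *\<^sub>R x - r *\<^sub>R orth_proj M x) g = 0" if "g \<in> M" for g
      using orth_proj_orthogonal[OF that, of x] by (simp add: inner_diff_left)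
  qed
next
  fix x
  have "(norm (orth_proj M x))\<^sup>2 = inner x (orth_proj M x)"
    using orth_proj_orthogonal[OF orth_proj_in, of x x]
    by (simp add: inner_diff_left power2_norm_eq_inner)
  also have "\<dots> \<le> norm x * norm (orth_proj M x)"
    by (rule norm_cauchy_schwarz)
  finally show "norm (orth_proj M x) \<le> norm x * 1"
    by (cases "orth_proj M x = 0") (auto simp: power2_eq_square)
qed

text \<open>Since the adjoint \<open>A'\<close> preserves \<open>M\<close>, the operator
  \<open>A\<close> preserves the orthogonal complement of \<open>M\<close>. Thus \<open>A\<close>
  respects the decomposition of \<open>x\<close>, and uniqueness applies.\<close>

lemma orth_proj_commute:
  assumes A: "bounded_linear A" "\<And>g. g \<in> M \<Longrightarrow> A g \<in> M"
    and A': "\<And>x y. inner (A x) y = inner x (A' y)" "\<And>g. g \<in> M \<Longrightarrow> A' g \<in> M"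
  shows "orth_proj M (A x) = A (orth_proj M x)"
proof (rule orth_proj_unique)
  show "A (orth_proj M x) \<in> M"
    by (intro A orth_proj_in)
  show "inner (A x - A (orth_proj M x)) g = 0" if "g \<in> M" for g
  proof -
    have "A x - A (orth_proj M x) = A (x - orth_proj M x)"
      by (simp add: linear_diff bounded_linear.linear[OF A(1)])
    then show ?thesis
      using A' orth_proj_orthogonal that by simp
  qed
qed

end

text \<open>The part \<open>u\<close> of a vector outside the kernel that is orthogonal to the
  kernel suffices: every \<open>x\<close> differs from \<open>(f x / f u) *\<^sub>R u\<close> by a
  kernel element, so pairing with \<open>u\<close> recovers \<open>f x\<close> up to a
  scalar.\<close>

lemma riesz_representation:
  fixes f :: "'a::{real_inner, complete_space} \<Rightarrow> real"
  assumes f: "bounded_linear f"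
  shows "\<exists>u. \<forall>x. f x = inner x u"
proof (cases "\<forall>x. f x = 0")
  case True
  then show ?thesis by (intro exI[of _ 0]) simp
next
  case False
  then obtain z where z: "f z \<noteq> 0" by blast
  interpret f: bounded_linear f by (rule f)
  define N where "N = {x. f x = 0}"
  have N: "subspace N"
    by (auto simp: N_def subspace_def f.add f.scaleR)
  have "closed N"
    unfolding N_def
    by (intro closed_Collect_eq continuous_intros linear_continuous_on f)
  note N = N this
  define u where "u = z - orth_proj N z"
  have fu: "f u = f z"
    using orth_proj_in[OF N, of z] by (simp add: u_def N_def f.diff)
  have orth: "inner g u = 0" if "g \<in> N" for g
    using orth_proj_orthogonal[OF N that, of z] by (simp add: u_def inner_commute)
  have u0: "u \<noteq> 0"
    using fu z f.zero by metis
  have "f x = inner x ((f u / inner u u) *\<^sub>R u)" for x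
  proof -
    have "x - (f x / f u) *\<^sub>R u \<in> N"
      using z by (simp add: N_def f.diff f.scaleR fu)
    from orth[OF this] have "inner x u = (f x / f u) * inner u u"
      by (simp add: inner_diff_left)
    then show ?thesis
      using z u0 by (simp add: fu)
  qed
  then show ?thesis by blast
qed

section \<open>Adjoints of bounded operators between complex Hilbert spaces\<close>

lemma cinner_scaleC_left:
  fixes x y :: "'a::complex_inner"
  shows "cinner (a *\<^sub>C x) y = cnj a * cinner x y"
  by (subst (1 2) cinner_commute) (simp add: cinner_scaleC_right)

text \<open>Conjugate-linearity in the first argument makes
  \<open>cinner (\<i> *\<^sub>C x) y\<close> equal to \<open>- \<i> * cinner x y\<close>, whose real
  part is the imaginary part of \<open>cinner x y\<close>. Real adjoint relations can thus be lifted
  to complex ones.\<close>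

lemma cinner_eq_inner:
  fixes x y :: "'a::complex_inner"
  shows "cinner x y = Complex (inner x y) (inner (\<i> *\<^sub>C x) y)"
  by (rule complex_eqI) (simp_all add: inner_eq_Re_cinner cinner_scaleC_left)

lemma inner_scaleC_left:
  fixes x y :: "'a::complex_inner"
  shows "inner (a *\<^sub>C x) y = inner x (cnj a *\<^sub>C y)"
  by (simp add: inner_eq_Re_cinner cinner_scaleC_left cinner_scaleC_right)

lemma cblinfun_bounded_linear: "bounded_linear (cblinfun_apply T)"
  and cblinfun_scaleC: "T *\<^sub>V (a *\<^sub>C x) = a *\<^sub>C (T *\<^sub>V x)"
  using cblinfun_apply[of T] by auto

lemma cblinfun_eqI: "(\<And>x. S *\<^sub>V x = T *\<^sub>V x) \<Longrightarrow> S = T"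
  by (metis cblinfun_apply_inject ext)

lemma inner_ext: "(\<And>x. inner x y = inner x z) \<Longrightarrow> y = z"
  by (rule vector_eq_ldot[THEN iffD1, rule_format])

text \<open>Riesz applied to \<open>inner (T *\<^sub>V x) y\<close> as a functional of
  \<open>x\<close> gives a real adjoint \<open>S\<close>. Complex linearity of \<open>T\<close> then
  makes \<open>S\<close> complex-linear and upgrades the relation to \<open>cinner\<close>.\<close>

lemma adjoint_exists:
  fixes T :: "('a::chilbert_space, 'b::chilbert_space) cblinfun"
  shows "\<exists>S :: ('b, 'a) cblinfun. \<forall>x y. cinner (T *\<^sub>V x) y = cinner x (S *\<^sub>V y)"
proof -
  interpret T: bounded_linear "cblinfun_apply T"
    by (rule cblinfun_bounded_linear)
  have "\<exists>u. \<forall>x. inner (T *\<^sub>V x) y = inner x u" for y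
    by (rule riesz_representation)
      (rule bounded_linear_compose[OF bounded_linear_inner_left T.bounded_linear])
  then obtain S where S: "\<And>x y. inner (T *\<^sub>V x) y = inner x (S y)"
    by metis
  obtain c where c: "0 < c" "\<And>x. norm (T *\<^sub>V x) \<le> norm x * c"
    using T.pos_bounded by blast
  have "bounded_linear S"
  proof (rule bounded_linear_intro[of _ c])
    show "S (x + y) = S x + S y" for x y
      by (rule inner_ext) (simp add: inner_add_right flip: S)
    show "S (r *\<^sub>R x) = r *\<^sub>R S x" for r x
      by (rule inner_ext) (simp flip: S)
    show "norm (S y) \<le> norm y * c" for y
    proof -
      have "norm (S y) * norm (S y) = inner (T *\<^sub>V S y) y"
        by (simp add: S flip: power2_norm_eq_inner power2_eq_square)
      also have "\<dots> \<le> (norm (S y) * c) * norm y"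
        using norm_cauchy_schwarz[of "T *\<^sub>V S y" y] c(2)[of "S y"]
        by (meson mult_right_mono norm_ge_zero order_trans)
      finally have "norm (S y) * norm (S y) \<le> norm (S y) * (norm y * c)"
        by (simp add: ac_simps)
      then show ?thesis
        using c(1) by (cases "S y = 0") auto
    qed
  qed
  moreover have "S (a *\<^sub>C y) = a *\<^sub>C S y" for a y
  proof (rule inner_ext)
    fix x
    have "inner x (a *\<^sub>C S y) = inner (cnj a *\<^sub>C x) (S y)"
      by (simp add: inner_scaleC_left)
    also have "\<dots> = inner x (S (a *\<^sub>C y))"
      by (simp add: cblinfun_scaleC inner_scaleC_left flip: S)
    finally show "inner x (S (a *\<^sub>C y)) = inner x (a *\<^sub>C S y)" ..
  qed
  ultimately have app: "cblinfun_apply (CBlinfun S) = S"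
    by (intro CBlinfun_inverse) simp
  have "cinner (T *\<^sub>V x) y = cinner x (CBlinfun S *\<^sub>V y)" for x y
    \<comment> \<open>For the imaginary part, \<open>\<i>\<close> is moved inside \<open>T\<close>,
      so that the real adjoint relation applies at \<open>\<i> *\<^sub>C x\<close>.\<close>
    unfolding cinner_eq_inner app S cblinfun_scaleC[symmetric] ..
  then show ?thesis
    by (intro exI[of _ "CBlinfun S"]) simp
qed

lemma cinner_ext:
  fixes y z :: "'a::complex_inner"
  assumes "\<And>x. cinner x y = cinner x z"
  shows "y = z"
proof (rule inner_ext)
  show "inner x y = inner x z" for x
    by (simp only: inner_eq_Re_cinner assms)
qed

text \<open>This discharges the definite description in \<open>adj\<close>: existence is
  \<open>adjoint_exists\<close>, uniqueness is \<open>cinner_ext\<close>.\<close>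

lemma cinner_adj: "cinner (T *\<^sub>V x) y = cinner x (adj T *\<^sub>V y)"
proof -
  let ?A = "\<lambda>S. \<forall>x y. cinner (T *\<^sub>V x) y = cinner x (S *\<^sub>V y)"
  obtain S where S: "?A S"
    using adjoint_exists[of T] by blast
  have "S' = S" if "?A S'" for S'
  proof (rule cblinfun_eqI)
    show "S' *\<^sub>V y = S *\<^sub>V y" for y
      using that S by (metis cinner_ext)
  qed
  then have "adj T = S"
    unfolding adj_def using S by (intro the_equality)
  then show ?thesis
    using S by simp
qed

lemma inner_adj: "inner (T *\<^sub>V x) y = inner x (adj T *\<^sub>V y)"
  by (simp add: inner_eq_Re_cinner cinner_adj)

lemma adj_eqI:
  assumes "\<And>x y. cinner (T *\<^sub>V x) y = cinner x (S *\<^sub>V y)"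
  shows "adj T = S"
  using assms by (intro cblinfun_eqI cinner_ext) (simp flip: cinner_adj)

lemma adj_adj: "adj (adj T) = T"
  by (rule adj_eqI) (metis cinner_adj cinner_commute)

lemma cblinfun_compose_apply [simp]: "(S o\<^sub>C T) *\<^sub>V x = S *\<^sub>V (T *\<^sub>V x)"
  by transfer simp

lemma cblinfun_compose_assoc: "(R o\<^sub>C S) o\<^sub>C T = R o\<^sub>C (S o\<^sub>C T)"
  by (rule cblinfun_eqI) simp

lemma adj_compose: "adj (S o\<^sub>C T) = adj T o\<^sub>C adj S"
  by (rule adj_eqI) (simp add: cinner_adj)

section \<open>The bimodule property\<close>

lemma csubspace_theta_hat: "csubspace (theta_hat V ` commutant M)"
proof (rule complex_vector.subspaceI)
  have app: "(S + T) *\<^sub>V x = S *\<^sub>V x + T *\<^sub>V x" "(a *\<^sub>C S) *\<^sub>V x = a *\<^sub>C (S *\<^sub>V x)"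
    "0 *\<^sub>V x = 0" for S T :: "('x::complex_inner, 'y::complex_inner) cblinfun" and x a
    by (transfer; simp)+
  have add: "T *\<^sub>V (x + y) = T *\<^sub>V x + T *\<^sub>V y" and zero: "T *\<^sub>V 0 = 0"
    for T :: "('x::complex_inner, 'y::complex_inner) cblinfun" and x y
    using linear_add linear_0 bounded_linear.linear[OF cblinfun_bounded_linear] by blast+
  have "0 \<in> commutant M"
    by (auto simp: commutant_def app zero intro!: cblinfun_eqI)
  moreover have "theta_hat V 0 = 0"
    by (rule cblinfun_eqI) (simp add: theta_hat_def app zero)
  ultimately show "0 \<in> theta_hat V ` commutant M"
    by (metis imageI)
  fix s t assume "s \<in> theta_hat V ` commutant M" "t \<in> theta_hat V ` commutant M"
  then obtain x y where xy: "x \<in> commutant M" "y \<in> commutant M"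
    "s = theta_hat V x" "t = theta_hat V y" by blast
  have distr: "(x + y) o\<^sub>C b = (x o\<^sub>C b) + (y o\<^sub>C b)" "b o\<^sub>C (x + y) = (b o\<^sub>C x) + (b o\<^sub>C y)" for b
    by (auto simp: app add intro!: cblinfun_eqI)
  have "x + y \<in> commutant M"
    using xy by (simp add: commutant_def distr)
  moreover have "theta_hat V (x + y) = s + t"
    unfolding xy by (rule cblinfun_eqI) (simp add: theta_hat_def app add)
  ultimately show "s + t \<in> theta_hat V ` commutant M"
    by (metis imageI)
next
  have app: "(a *\<^sub>C S) *\<^sub>V x = a *\<^sub>C (S *\<^sub>V x)"
    for S :: "('x::complex_inner, 'y::complex_inner) cblinfun" and x a
    by transfer simp
  fix a s assume "s \<in> theta_hat V ` commutant M"
  then obtain x where x: "x \<in> commutant M" "s = theta_hat V x" by blast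
  have comp: "(a *\<^sub>C x) o\<^sub>C b = a *\<^sub>C (x o\<^sub>C b)" "b o\<^sub>C (a *\<^sub>C x) = a *\<^sub>C (b o\<^sub>C x)" for b
    by (auto simp: app cblinfun_scaleC intro!: cblinfun_eqI)
  have "a *\<^sub>C x \<in> commutant M"
    using x by (simp add: commutant_def comp)
  moreover have "theta_hat V (a *\<^sub>C x) = a *\<^sub>C s"
    unfolding x by (rule cblinfun_eqI) (simp add: theta_hat_def app cblinfun_scaleC)
  ultimately show "a *\<^sub>C s \<in> theta_hat V ` commutant M"
    by (metis imageI)
qed

lemma commutant_compose: "x \<in> commutant M \<Longrightarrow> y \<in> commutant M \<Longrightarrow> x o\<^sub>C y \<in> commutant M"
  unfolding commutant_def using cblinfun_compose_assoc by (smt (verit) mem_Collect_eq)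

text \<open>Take adjoints in the commutation relation of \<open>x\<close> with
  \<open>adj b\<close>.\<close>

lemma commutant_adj:
  assumes "\<And>b. b \<in> M \<Longrightarrow> adj b \<in> M" "x \<in> commutant M"
  shows "adj x \<in> commutant M"
proof -
  have "adj x o\<^sub>C b = b o\<^sub>C adj x" if "b \<in> M" for b
  proof -
    have "x o\<^sub>C adj b = adj b o\<^sub>C x"
      using assms that by (simp add: commutant_def)
    then have "adj (x o\<^sub>C adj b) = adj (adj b o\<^sub>C x)"
      by simp
    then show ?thesis
      by (simp add: adj_compose adj_adj)
  qed
  then show ?thesis
    by (simp add: commutant_def)
qed

lemma quantum_graph_theta_hat:
  assumes B: "unital_star_subalgebra B" and dil: "stinespring_dilation B \<theta> V \<rho> \<pi>"
  shows "quantum_graph B (theta_hat V ` commutant (range \<pi>))"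
  unfolding quantum_graph_def
proof (intro conjI ballI csubspace_theta_hat)
  fix x z s
  assume x: "x \<in> commutant B" and z: "z \<in> commutant B"
    and "s \<in> theta_hat V ` commutant (range \<pi>)"
  then obtain y where y: "y \<in> commutant (range \<pi>)" "s = theta_hat V y"
    by blast
  have x': "adj x \<in> commutant B"
    using B x by (intro commutant_adj) (simp_all add: unital_star_subalgebra_def)
  have \<rho>: "\<rho> w \<in> commutant (range \<pi>)" "\<rho> w o\<^sub>C V = V o\<^sub>C w" "\<rho> (adj w) = adj (\<rho> w)"
    if "w \<in> commutant B" for w
    using dil that by (auto simp: stinespring_dilation_def normal_unital_star_hom_def)
  \<comment> \<open>A dilation only provides \<open>\<rho> w o\<^sub>C V = V o\<^sub>C w\<close>.
    The mirrored relation needed on the left comes from taking \<open>w = adj x\<close>, which is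
    why \<open>adj x\<close> had to be in the commutant, and passing to adjoints.\<close>
  have "x o\<^sub>C adj V = adj (V o\<^sub>C adj x)"
    by (simp add: adj_compose adj_adj)
  also have "\<dots> = adj (adj (\<rho> x) o\<^sub>C V)"
    using \<rho>(2)[OF x'] \<rho>(3)[OF x] by simp
  finally have left: "x o\<^sub>C adj V = adj V o\<^sub>C \<rho> x"
    by (simp add: adj_compose adj_adj)
  have "x o\<^sub>C s o\<^sub>C z = (x o\<^sub>C adj V) o\<^sub>C y o\<^sub>C (V o\<^sub>C z)"
    by (simp add: y theta_hat_def cblinfun_compose_assoc)
  also have "\<dots> = theta_hat V (\<rho> x o\<^sub>C y o\<^sub>C \<rho> z)"
    by (simp add: left theta_hat_def cblinfun_compose_assoc flip: \<rho>(2)[OF z])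
  finally show "x o\<^sub>C s o\<^sub>C z \<in> theta_hat V ` commutant (range \<pi>)"
    using \<rho>(1)[OF x] \<rho>(1)[OF z] y(1) commutant_compose by (metis imageI)
qed

section \<open>Independence of the dilation\<close>

text \<open>The fixed vectors of \<open>\<pi> 1\<close> form a closed subspace containing every
  \<open>\<pi> c *\<^sub>V \<xi>\<close>, hence the whole space. With \<open>c = 1\<close> this puts
  the pairs \<open>(V' *\<^sub>V \<xi>, V *\<^sub>V \<xi>)\<close> into \<open>X\<close>
  below.\<close>

lemma star_representation_one:
  assumes \<pi>: "star_representation \<pi>" and nd: "nondegenerate \<pi>"
  shows "\<pi> 1 = id_cblinfun"
proof (rule cblinfun_eqI)
  fix v
  interpret one: bounded_linear "cblinfun_apply (\<pi> 1)"
    by (rule cblinfun_bounded_linear)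
  let ?F = "{v. \<pi> 1 *\<^sub>V v = v}"
  have "csubspace ?F"
    by (rule complex_vector.subspaceI) (auto simp: one.add one.zero cblinfun_scaleC)
  moreover have "\<pi> 1 *\<^sub>V (\<pi> c *\<^sub>V \<xi>) = \<pi> c *\<^sub>V \<xi>" for c \<xi>
    using \<pi> unfolding star_representation_def by (metis cblinfun_compose_apply mult_1)
  then have "{\<pi> c *\<^sub>V \<xi> | c \<xi>. True} \<subseteq> ?F"
    by auto
  ultimately have "cspan {\<pi> c *\<^sub>V \<xi> | c \<xi>. True} \<subseteq> ?F"
    by (simp add: complex_vector.span_minimal)
  moreover have "closed ?F"
    by (intro closed_Collect_eq continuous_intros linear_continuous_on one.bounded_linear)
  ultimately have "v \<in> ?F"
    using nd closure_minimal unfolding nondegenerate_def by blast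
  moreover have "id_cblinfun *\<^sub>V v = v"
    by transfer simp
  ultimately show "\<pi> 1 *\<^sub>V v = id_cblinfun *\<^sub>V v"
    by simp
qed

text \<open>
  The closed span \<open>G\<close> of the pairs \<open>(\<pi>'(c) V' \<xi>, \<pi>(c) V \<xi>)\<close> is the graph of an isometry
  \<open>U\<close>, so its orthogonal projection sends \<open>(x, 0)\<close> to \<open>(p, U p) / 2\<close>, where \<open>p\<close> is the
  projection of \<open>x\<close> onto the domain of \<open>U\<close>.  Reading \<open>T\<close> off this projection avoids
  constructing \<open>U\<close>.
\<close>

lemma intertwiner_exists:
  fixes \<pi> :: "'c::unital_cstar_algebra \<Rightarrow> ('k::chilbert_space, 'k) cblinfun"
    and \<pi>' :: "'c \<Rightarrow> ('l::chilbert_space, 'l) cblinfun"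
    and V :: "('h::chilbert_space, 'k) cblinfun" and V' :: "('h, 'l) cblinfun"
  assumes \<pi>: "star_representation \<pi>" "nondegenerate \<pi>"
    and \<pi>': "star_representation \<pi>'" "nondegenerate \<pi>'"
    and eq: "\<And>c. adj V o\<^sub>C \<pi> c o\<^sub>C V = adj V' o\<^sub>C \<pi>' c o\<^sub>C V'"
  obtains T :: "('l, 'k) cblinfun"
    where "\<And>c. T o\<^sub>C \<pi>' c = \<pi> c o\<^sub>C T" and "T o\<^sub>C V' = V"
proof -
  define X where "X = {(\<pi>' c *\<^sub>V (V' *\<^sub>V \<xi>), \<pi> c *\<^sub>V (V *\<^sub>V \<xi>)) | c \<xi>. True}"
  \<comment> \<open>The span is real. As \<open>X\<close> is stable under complex scalars acting on
    \<xi>, the maps \<open>E a\<close> preserve \<open>G\<close>, which restores the complex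
    structure.\<close>
  define G where "G = closure (span X)"
  have G: "subspace G" "closed G"
    by (simp_all add: G_def subspace_closure)
  have rep: "\<sigma> (a * b) = \<sigma> a o\<^sub>C \<sigma> b" "\<sigma> (star a) = adj (\<sigma> a)"
    if "star_representation \<sigma>"
    for a b and \<sigma> :: "'c \<Rightarrow> ('x::chilbert_space, 'x) cblinfun"
    using that by (auto simp: star_representation_def)
  \<comment> \<open>\<open>D\<close> is the direct sum of the two representations and
    \<open>E\<close> is scalar multiplication on the product. Their adjoints
    \<open>D (star d)\<close> and \<open>E (cnj a)\<close> are of the same form, so the projection
    onto \<open>G\<close> commutes with all of them.\<close>
  define D where "D d = (\<lambda>(a, b). (\<pi>' d *\<^sub>V a, \<pi> d *\<^sub>V b))" for d
  define E where "E a = (\<lambda>(u :: 'l, v :: 'k). (a *\<^sub>C u, a *\<^sub>C v))" for a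
  have bl: "bounded_linear (D d)" "bounded_linear (E a)" for d a
    unfolding D_def E_def case_prod_beta
    by (intro bounded_linear_Pair bounded_linear_compose[OF cblinfun_bounded_linear]
      bounded_linear_compose[OF bounded_linear_scaleC] bounded_linear_fst bounded_linear_snd)+
  have D: "D d g \<in> G" if "g \<in> G" for d g
    unfolding G_def
  proof (rule bounded_linear_maps_closure_span[OF bl(1) _ that[unfolded G_def]])
    fix x assume "x \<in> X"
    then obtain c \<xi> where "x = (\<pi>' c *\<^sub>V (V' *\<^sub>V \<xi>), \<pi> c *\<^sub>V (V *\<^sub>V \<xi>))"
      by (auto simp: X_def)
    then have "D d x = (\<pi>' (d * c) *\<^sub>V (V' *\<^sub>V \<xi>), \<pi> (d * c) *\<^sub>V (V *\<^sub>V \<xi>))"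
      by (simp add: D_def rep \<pi> \<pi>')
    then show "D d x \<in> X"
      unfolding X_def by blast
  qed
  have E: "E a g \<in> G" if "g \<in> G" for a g
    unfolding G_def
  proof (rule bounded_linear_maps_closure_span[OF bl(2) _ that[unfolded G_def]])
    fix x assume "x \<in> X"
    then obtain c \<xi> where "x = (\<pi>' c *\<^sub>V (V' *\<^sub>V \<xi>), \<pi> c *\<^sub>V (V *\<^sub>V \<xi>))"
      by (auto simp: X_def)
    then have "E a x = (\<pi>' c *\<^sub>V (V' *\<^sub>V (a *\<^sub>C \<xi>)), \<pi> c *\<^sub>V (V *\<^sub>V (a *\<^sub>C \<xi>)))"
      by (simp add: E_def cblinfun_scaleC)
    then show "E a x \<in> X"
      unfolding X_def by blast
  qed
  let ?P = "orth_proj G"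
  have PD: "?P (D d x) = D d (?P x)" for d x
  proof (rule orth_proj_commute[OF G bl(1), where A' = "D (star d)"])
    show "inner (D d u) v = inner u (D (star d) v)" for u v
      by (cases u; cases v) (simp add: D_def rep \<pi> \<pi>' inner_adj)
  qed (erule D)+
  have PE: "?P (E a x) = E a (?P x)" for a x
  proof (rule orth_proj_commute[OF G bl(2), where A' = "E (cnj a)"])
    show "inner (E a u) v = inner u (E (cnj a) v)" for u v
      by (cases u; cases v) (simp add: E_def inner_scaleC_left)
  qed (erule E)+
  have one: "\<pi> 1 *\<^sub>V v = v" "\<pi>' 1 *\<^sub>V w = w" for v w
    using star_representation_one[OF \<pi>] star_representation_one[OF \<pi>']
    by (simp_all add: id_cblinfun.rep_eq)
  have V_in_X: "(V' *\<^sub>V \<xi>, V *\<^sub>V \<xi>) \<in> X" for \<xi>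
    unfolding X_def using one by (metis (mono_tags, lifting) mem_Collect_eq)
  \<comment> \<open>Here the hypothesis \<open>eq\<close> enters: on a generator the two summands
    are the inner products of \<xi> with the two sides of \<open>eq\<close> applied to \<eta>, and
    they cancel.\<close>
  have orth: "inner (V' *\<^sub>V \<xi>, - (V *\<^sub>V \<xi>)) g = 0" if "g \<in> G" for \<xi> g
  proof -
    let ?N = "{g. inner (V' *\<^sub>V \<xi>, - (V *\<^sub>V \<xi>)) g = 0}"
    have "X \<subseteq> ?N"
    proof
      fix x assume "x \<in> X"
      then obtain c \<eta> where x: "x = (\<pi>' c *\<^sub>V (V' *\<^sub>V \<eta>), \<pi> c *\<^sub>V (V *\<^sub>V \<eta>))"
        by (auto simp: X_def)
      have "adj V *\<^sub>V (\<pi> c *\<^sub>V (V *\<^sub>V \<eta>)) = adj V' *\<^sub>V (\<pi>' c *\<^sub>V (V' *\<^sub>V \<eta>))"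
        using arg_cong[OF eq, of "\<lambda>T. T *\<^sub>V \<eta>"] by simp
      then show "x \<in> ?N"
        by (simp add: x inner_adj)
    qed
    moreover have "subspace ?N"
      by (auto simp: subspace_def inner_add_right)
    moreover have "closed ?N"
      by (intro closed_Collect_eq continuous_intros)
    ultimately have "G \<subseteq> ?N"
      unfolding G_def by (intro closure_minimal span_minimal)
    then show ?thesis
      using that by blast
  qed
  \<comment> \<open>The factor 2 undoes the 1/2 that arises when \<open>(x, 0)\<close> is projected
    onto a graph of an isometry.\<close>
  define f where "f x = 2 *\<^sub>R snd (?P (x, 0))" for x
  have "bounded_linear f"
    unfolding f_def
    by (intro bounded_linear_compose[OF bounded_linear_scaleR_right]
      bounded_linear_compose[OF bounded_linear_snd]
      bounded_linear_compose[OF bounded_linear_orth_proj[OF G]]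
      bounded_linear_Pair bounded_linear_ident bounded_linear_zero)
  moreover have "f (a *\<^sub>C x) = a *\<^sub>C f x" for a x
    using PE[of a "(x, 0)"]
    by (simp add: f_def E_def case_prod_beta scaleR_scaleC scaleC_scaleC mult.commute
      complex_vector.scale_zero_right)
  ultimately have f: "cblinfun_apply (CBlinfun f) = f"
    by (intro CBlinfun_inverse) simp
  show thesis
  proof (rule that[of "CBlinfun f"])
    show "CBlinfun f o\<^sub>C \<pi>' d = \<pi> d o\<^sub>C CBlinfun f" for d
    proof (rule cblinfun_eqI)
      fix x
      interpret d: bounded_linear "cblinfun_apply (\<pi> d)"
        by (rule cblinfun_bounded_linear)
      show "(CBlinfun f o\<^sub>C \<pi>' d) *\<^sub>V x = (\<pi> d o\<^sub>C CBlinfun f) *\<^sub>V x"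
        \<comment> \<open>\<open>D d\<close> maps \<open>(x, 0)\<close> to
          \<open>(\<pi>' d *\<^sub>V x, 0)\<close>, so the second component of \<open>PD\<close> is
          the intertwining relation.\<close>
        using PD[of d "(x, 0)"] by (simp add: f f_def D_def case_prod_beta d.zero d.scaleR)
    qed
    show "CBlinfun f o\<^sub>C V' = V"
    proof (rule cblinfun_eqI)
      fix \<xi>
      \<comment> \<open>\<open>(V' *\<^sub>V \<xi>, 0)\<close> is half the sum of
        \<open>(V' *\<^sub>V \<xi>, V *\<^sub>V \<xi>)\<close>, in \<open>G\<close>, and
        \<open>(V' *\<^sub>V \<xi>, - (V *\<^sub>V \<xi>))\<close>, orthogonal to
        \<open>G\<close>.\<close>
      have "?P (V' *\<^sub>V \<xi>, 0) = (1/2) *\<^sub>R (V' *\<^sub>V \<xi>, V *\<^sub>V \<xi>)"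
      proof (rule orth_proj_unique[OF G])
        show "(1/2) *\<^sub>R (V' *\<^sub>V \<xi>, V *\<^sub>V \<xi>) \<in> G"
          unfolding G_def using V_in_X closure_subset span_base span_scale by blast
        have half: "(V' *\<^sub>V \<xi>, 0) - (1/2) *\<^sub>R (V' *\<^sub>V \<xi>, V *\<^sub>V \<xi>)
            = (1/2) *\<^sub>R (V' *\<^sub>V \<xi>, - (V *\<^sub>V \<xi>))"
          using scaleR_left.add[of "1/2" "1/2" "V' *\<^sub>V \<xi>"]
          by (simp add: algebra_simps)
        show "inner ((V' *\<^sub>V \<xi>, 0) - (1/2) *\<^sub>R (V' *\<^sub>V \<xi>, V *\<^sub>V \<xi>)) g = 0"
          if "g \<in> G" for g
          by (simp only: half inner_scaleR_left orth[OF that] mult_zero_right)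
      qed
      then show "(CBlinfun f o\<^sub>C V') *\<^sub>V \<xi> = V *\<^sub>V \<xi>"
        by (simp add: f f_def)
    qed
  qed
qed

lemma theta_hat_image_subset:
  fixes V :: "('h::chilbert_space, 'k::chilbert_space) cblinfun"
    and V' :: "('h, 'l::chilbert_space) cblinfun"
  assumes dil: "stinespring_dilation B \<theta> V \<rho> \<pi>" and dil': "stinespring_dilation B \<theta> V' \<rho>' \<pi>'"
  shows "theta_hat V ` commutant (range \<pi>) \<subseteq> theta_hat V' ` commutant (range \<pi>')"
proof
  fix s assume "s \<in> theta_hat V ` commutant (range \<pi>)"
  then obtain y where y: "y \<in> commutant (range \<pi>)" "s = theta_hat V y"
    by blast
  have \<pi>: "star_representation \<pi>" "nondegenerate \<pi>" "\<And>c. \<theta> c = adj V o\<^sub>C \<pi> c o\<^sub>C V"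
    using dil by (auto simp: stinespring_dilation_def)
  have \<pi>': "star_representation \<pi>'" "nondegenerate \<pi>'" "\<And>c. \<theta> c = adj V' o\<^sub>C \<pi>' c o\<^sub>C V'"
    using dil' by (auto simp: stinespring_dilation_def)
  obtain T where T: "\<And>c. T o\<^sub>C \<pi>' c = \<pi> c o\<^sub>C T" "T o\<^sub>C V' = V"
    using intertwiner_exists[OF \<pi>(1,2) \<pi>'(1,2)] \<pi>(3) \<pi>'(3) by metis
  have T': "adj T o\<^sub>C \<pi> c = \<pi>' c o\<^sub>C adj T" for c
  proof -
    \<comment> \<open>Starting from \<open>star c\<close> makes the adjoints of the representing
      operators come out at \<open>c\<close> itself.\<close>
    have "adj (T o\<^sub>C \<pi>' (star c)) = adj (\<pi> (star c) o\<^sub>C T)"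
      by (simp add: T)
    then show ?thesis
      using \<pi>(1) \<pi>'(1) by (simp add: star_representation_def adj_compose adj_adj)
  qed
  have "(adj T o\<^sub>C y o\<^sub>C T) o\<^sub>C \<pi>' c = \<pi>' c o\<^sub>C (adj T o\<^sub>C y o\<^sub>C T)" for c
  proof -
    have "(adj T o\<^sub>C y o\<^sub>C T) o\<^sub>C \<pi>' c = adj T o\<^sub>C (y o\<^sub>C \<pi> c) o\<^sub>C T"
      by (simp add: cblinfun_compose_assoc T)
    also have "\<dots> = (adj T o\<^sub>C \<pi> c) o\<^sub>C y o\<^sub>C T"
      using y(1) by (simp add: commutant_def cblinfun_compose_assoc)
    finally show ?thesis
      by (simp add: T' cblinfun_compose_assoc)
  qed
  then have "adj T o\<^sub>C y o\<^sub>C T \<in> commutant (range \<pi>')"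
    by (auto simp: commutant_def)
  moreover have "theta_hat V' (adj T o\<^sub>C y o\<^sub>C T) = s"
    by (simp add: y theta_hat_def adj_compose cblinfun_compose_assoc flip: T(2))
  ultimately show "s \<in> theta_hat V' ` commutant (range \<pi>')"
    by (metis imageI)
qed

theorem theorem6p4:
  fixes B :: "('h::chilbert_space, 'h) cblinfun set"
    and \<theta> :: "'c::unital_cstar_algebra \<Rightarrow> ('h, 'h) cblinfun"
    and V :: "('h, 'k::chilbert_space) cblinfun"
    and \<rho> :: "('h, 'h) cblinfun \<Rightarrow> ('k, 'k) cblinfun"
    and \<pi> :: "'c \<Rightarrow> ('k, 'k) cblinfun"
  assumes "finite_cdim (UNIV :: 'h set)"
    and "unital_star_subalgebra B" and "finite_cdim B"
    and "ucp_map B \<theta>"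
    and "stinespring_dilation B \<theta> V \<rho> \<pi>"
  shows "quantum_graph B (theta_hat V ` commutant (range \<pi>)) \<and>
    (\<forall>(V' :: ('h, 'k'::chilbert_space) cblinfun)
       (\<rho>' :: ('h, 'h) cblinfun \<Rightarrow> ('k', 'k') cblinfun)
       (\<pi>' :: 'c \<Rightarrow> ('k', 'k') cblinfun).
       stinespring_dilation B \<theta> V' \<rho>' \<pi>' \<longrightarrow>
       theta_hat V' ` commutant (range \<pi>') = theta_hat V ` commutant (range \<pi>))"
  \<comment> \<open>Equality of the images is the inclusion used twice, with the two dilations
    exchanged.\<close>
  using quantum_graph_theta_hat[OF assms(2,5)] theta_hat_image_subset[OF assms(5)]
    theta_hat_image_subset[OF _ assms(5)]
  by (intro conjI allI impI subset_antisym)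

end
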